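(* Let $n\geq 4$ be an integer. There is no chordal graph $G$ such that either the clique graph $C(G)$ or the reduced clique graph $C_R(G)$ is (isomorphic to) a cycle with $n$ vertices.
   Context: All graphs are finite and simple. A graph is chordal if every cycle with at least four vertices has a chord (an edge joining two vertices of the cycle that is not in the cycle). A clique is a set of pairwise adjacent vertices; maximal cliques are maximal with respect to inclusion. For a set $S$ of vertices, a path is $S$-avoiding if no internal vertex of the path is in $S$. The clique graph $C(G)$ of a chordal graph $G$ has the maximal cliques of $G$ as its vertices; two distinct maximal cliques are adjacent in $C(G)$ if and only if they have non-empty intersection. The reduced clique graph $C_R(G)$ has the same vertices; distinct maximal cliques $C$ and $C'$ are adjacent in $C_R(G)$ if and only if $C\cap C'\neq\emptyset$ and $C,C'$ form a separating pair, meaning that there is no $(C\cap C')$-avoiding path of $G$ from a vertex in $C-C'$ to a vertex in $C'-C$. *)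

theory Defs
  imports "Graph_Theory.Graph_Theory"
begin

text \<open>
  Finite simple graphs are modelled by the locale \<^locale>\<open>graph\<close>: every edge is represented
  by its two opposite arcs.
\<close>

text \<open>
  A chord of a cycle \<open>p\<close> (a list of arcs); an edge of \<open>G\<close> lies on \<open>p\<close> as soon as one of its
  two arcs does. The vertices of a cycle are the tails of its arcs.
\<close>
definition is_chord :: "('a, 'b) pre_digraph \<Rightarrow> 'b list \<Rightarrow> 'a \<Rightarrow> 'a \<Rightarrow> bool" where
  "is_chord G p u v \<longleftrightarrow>
     u \<in> tail G ` set p \<and> v \<in> tail G ` set p \<and> u \<rightarrow>\<^bsub>G\<^esub> v \<and>
     (u, v) \<notin> arc_to_ends G ` set p \<and> (v, u) \<notin> arc_to_ends G ` set p"

text \<open>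
  A cycle in the sense of \<^const>\<open>pre_digraph.cycle\<close> has exactly \<open>length p\<close> vertices; the
  degenerate cycles \<open>u, v, u\<close> of length two are excluded by the length bound.
\<close>
definition chordal :: "('a, 'b) pre_digraph \<Rightarrow> bool" where
  "chordal G \<longleftrightarrow>
     (\<forall>p. pre_digraph.cycle G p \<and> 4 \<le> length p \<longrightarrow> (\<exists>u v. is_chord G p u v))"

definition clique :: "('a, 'b) pre_digraph \<Rightarrow> 'a set \<Rightarrow> bool" where
  "clique G C \<longleftrightarrow> C \<subseteq> verts G \<and> (\<forall>u\<in>C. \<forall>v\<in>C. u \<noteq> v \<longrightarrow> u \<rightarrow>\<^bsub>G\<^esub> v)"

definition maximal_clique :: "('a, 'b) pre_digraph \<Rightarrow> 'a set \<Rightarrow> bool" where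
  "maximal_clique G C \<longleftrightarrow> clique G C \<and> (\<forall>D. clique G D \<and> C \<subseteq> D \<longrightarrow> D = C)"

definition avoiding_path :: "('a, 'b) pre_digraph \<Rightarrow> 'a set \<Rightarrow> 'a \<Rightarrow> 'b list \<Rightarrow> 'a \<Rightarrow> bool" where
  "avoiding_path G S u p v \<longleftrightarrow>
     pre_digraph.apath G u p v \<and> set (pre_digraph.inner_verts G p) \<inter> S = {}"

definition separating_pair :: "('a, 'b) pre_digraph \<Rightarrow> 'a set \<Rightarrow> 'a set \<Rightarrow> bool" where
  "separating_pair G C C' \<longleftrightarrow>
     \<not> (\<exists>u v p. u \<in> C - C' \<and> v \<in> C' - C \<and> avoiding_path G (C \<inter> C') u p v)"

definition clique_graph :: "('a, 'b) pre_digraph \<Rightarrow> 'a set pair_pre_digraph" where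
  "clique_graph G = \<lparr>
     pverts = {C. maximal_clique G C},
     parcs = {(C, C'). maximal_clique G C \<and> maximal_clique G C' \<and> C \<noteq> C' \<and> C \<inter> C' \<noteq> {}} \<rparr>"

definition reduced_clique_graph :: "('a, 'b) pre_digraph \<Rightarrow> 'a set pair_pre_digraph" where
  "reduced_clique_graph G = \<lparr>
     pverts = {C. maximal_clique G C},
     parcs = {(C, C'). maximal_clique G C \<and> maximal_clique G C' \<and> C \<noteq> C' \<and>
                       C \<inter> C' \<noteq> {} \<and> separating_pair G C C'} \<rparr>"

text \<open>The cycle with \<open>n\<close> vertices; it is a simple graph only for \<open>n \<ge> 3\<close>.\<close>
definition cycle_graph :: "nat \<Rightarrow> nat pair_pre_digraph" where
  "cycle_graph n = \<lparr>
     pverts = {..<n},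
     parcs = {(i, j). i < n \<and> j < n \<and> (j = (i + 1) mod n \<or> i = (j + 1) mod n)} \<rparr>"

text \<open>
  On pair digraphs \<^const>\<open>digraph_iso\<close> is isomorphism in the usual sense: a bijection of the
  vertices that preserves and reflects adjacency.
\<close>
lemma digraph_iso_with_proj_iff:
  assumes "pair_wf_digraph H" "pair_wf_digraph K"
  shows "digraph_iso (with_proj H) (with_proj K) \<longleftrightarrow>
    (\<exists>f. bij_betw f (pverts H) (pverts K) \<and>
         (\<forall>u\<in>pverts H. \<forall>v\<in>pverts H. (u, v) \<in> parcs H \<longleftrightarrow> (f u, f v) \<in> parcs K))"
  (is "?L \<longleftrightarrow> ?R")
proof
  assume ?L
  then obtain h where h: "pre_digraph.digraph_isomorphism (with_proj H) h"
    and K: "with_proj K = app_iso h (with_proj H)"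
    unfolding digraph_iso_def by blast
  let ?f = "iso_verts h"
  have vK: "pverts K = ?f ` pverts H" and aK: "parcs K = iso_arcs h ` parcs H"
    and tK: "iso_tail h = fst" and hK: "iso_head h = snd"
    using K by (auto simp: with_proj_def app_iso_def)
  have inj: "inj_on ?f (pverts H)"
    and ends: "\<And>a. a \<in> parcs H \<Longrightarrow> iso_arcs h a = (?f (fst a), ?f (snd a))"
    using h unfolding pre_digraph.digraph_isomorphism_def tK hK by (simp_all add: prod_eq_iff)
  have aK': "parcs K = (\<lambda>a. (?f (fst a), ?f (snd a))) ` parcs H"
    unfolding aK using ends by (rule image_cong[OF refl])
  have "(u, v) \<in> parcs H \<longleftrightarrow> (?f u, ?f v) \<in> parcs K" if "u \<in> pverts H" "v \<in> pverts H" for u v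
  proof
    assume "(u, v) \<in> parcs H"
    then show "(?f u, ?f v) \<in> parcs K" unfolding aK' by force
  next
    assume "(?f u, ?f v) \<in> parcs K"
    then obtain x y where xy: "(x, y) \<in> parcs H" "?f u = ?f x" "?f v = ?f y"
      unfolding aK' by auto
    then show "(u, v) \<in> parcs H"
      using inj that pair_wf_digraph.in_arcsD1[OF assms(1)] pair_wf_digraph.in_arcsD2[OF assms(1)]
      by (metis inj_onD)
  qed
  then show ?R using inj vK by (auto simp: bij_betw_def)
next
  assume ?R
  then obtain f where f: "bij_betw f (pverts H) (pverts K)"
    and adj: "\<And>u v. u \<in> pverts H \<Longrightarrow> v \<in> pverts H \<Longrightarrow> (u, v) \<in> parcs H \<longleftrightarrow> (f u, f v) \<in> parcs K"
    by blast
  note wH = pair_wf_digraph.wellformed'[OF assms(1)]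
  note wK = pair_wf_digraph.wellformed'[OF assms(2)]
  let ?h = "\<lparr> iso_verts = f, iso_arcs = map_prod f f, iso_head = snd, iso_tail = fst \<rparr>"
  have inj: "inj_on f (pverts H)" and img: "f ` pverts H = pverts K"
    using f by (auto simp: bij_betw_def)
  have "inj_on (map_prod f f) (parcs H)"
    by (rule inj_on_subset[OF map_prod_inj_on[OF inj inj]]) (auto dest: wH)
  then have iso: "pre_digraph.digraph_isomorphism (with_proj H) ?h"
    using inj assms(1) by (simp add: pre_digraph.digraph_isomorphism_def wf_digraph_wp_iff)
  have "map_prod f f ` parcs H = parcs K"
  proof
    show "map_prod f f ` parcs H \<subseteq> parcs K"
    proof (rule image_subsetI)
      fix a assume a: "a \<in> parcs H"
      obtain u v where uv: "a = (u, v)" by (cases a)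
      show "map_prod f f a \<in> parcs K" using adj[OF wH[OF a[unfolded uv]]] a uv by simp
    qed
    show "parcs K \<subseteq> map_prod f f ` parcs H"
    proof clarify
      fix x y assume xy: "(x, y) \<in> parcs K"
      then obtain u v where uv: "u \<in> pverts H" "v \<in> pverts H" "x = f u" "y = f v"
        using wK[OF xy] img by blast
      then have "(u, v) \<in> parcs H" using adj[OF uv(1,2)] xy by simp
      then show "(x, y) \<in> map_prod f f ` parcs H"
        using uv(3,4) by (metis map_prod_simp imageI)
    qed
  qed
  then have "with_proj K = app_iso ?h (with_proj H)"
    using img by (simp add: app_iso_def with_proj_def)
  then show ?L unfolding digraph_iso_def using iso by blast
qed

end

theory Submission
  imports Defs
begin

text \<open>
  Everything rests on the reduced clique graph; write \<open>H\<close> for its adjacency.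

  The case of the clique graph reduces to it. If \<open>C\<close> and \<open>D\<close> meet without being a separating
  pair, then a shortest path from \<open>C - D\<close> to \<open>D - C\<close> around \<open>S = C \<inter> D\<close> consists, by chordality,
  of common neighbours of \<open>S\<close> (\<open>common_neighbour_of_ends\<close>). So \<open>C\<close> and \<open>D\<close> are joined by a chain
  of maximal cliques containing \<open>S\<close> (\<open>clique_chain\<close>, \<open>reduced_chain\<close>), and one of these forms a
  triangle with \<open>C\<close> and \<open>D\<close> in the clique graph. A cycle of length at least four has no
  triangle, so if the clique graph is such a cycle, it equals the reduced clique graph.

  Now suppose that \<open>H\<close> has no triangle, and let \<open>S = C \<inter> D\<close> for an edge \<open>C D\<close> of \<open>H\<close>. The maximal
  cliques containing \<open>S\<close> fall into classes according to the component of \<open>G - S\<close> in which they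
  live. Members of different classes are always adjacent in \<open>H\<close>, each class is connected in \<open>H\<close>,
  and \<open>C\<close> and \<open>D\<close> belong to different classes; so a third maximal clique containing \<open>S\<close> would
  give a triangle. Hence \<open>C\<close> and \<open>D\<close> are the only ones (\<open>only_two_cliques_above_edge\<close>).

  Finally choose the edge \<open>C D\<close> with \<open>|S|\<close> minimal. An edge of \<open>H\<close> between the component of
  \<open>C - S\<close> and the rest of \<open>G - S\<close> joins two cliques that meet inside \<open>S\<close>, hence, by minimality,
  exactly in \<open>S\<close>; by the previous paragraph it is the edge \<open>C D\<close> itself. So \<open>C D\<close> is a bridge of
  \<open>H\<close> (\<open>minimum_edge_is_bridge\<close>), and a cycle has no bridge.
\<close>

section \<open>Vertices connected outside a set\<close>

definition arcs_avoiding :: "('a, 'b) pre_digraph \<Rightarrow> 'a set \<Rightarrow> ('a \<times> 'a) set" where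
  "arcs_avoiding G S = {(u, v). u \<rightarrow>\<^bsub>G\<^esub> v \<and> u \<notin> S \<and> v \<notin> S}"

context graph
begin

lemma dominates_sym: "u \<rightarrow> v \<Longrightarrow> v \<rightarrow> u"
  using arcs_ends_symmetric[OF sym_arcs] .

lemma dominates_irrefl: "\<not> u \<rightarrow> u"
  using adj_not_same by blast

lemma avoiding_path_imp_rtrancl:
  assumes "avoiding_path G S u p v" "u \<notin> S" "v \<notin> S"
  shows "(u, v) \<in> (arcs_avoiding G S)\<^sup>*"
proof -
  have ap: "apath u p v" and inner: "set (inner_verts p) \<inter> S = {}"
    using assms(1) by (auto simp: avoiding_path_def)
  have "set (awalk_verts u p) \<inter> S = {}"
    using set_inner_verts[OF ap] inner assms(2,3) by blast
  then show ?thesis using awalkI_apath[OF ap]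
  proof (induction p arbitrary: u)
    case Nil
    then show ?case by (simp add: awalk_Nil_iff)
  next
    case (Cons e es)
    have w: "awalk (head G e) es v" and e: "e \<in> arcs G" "u = tail G e"
      using Cons.prems(2) by (auto simp: awalk_Cons_iff)
    have "head G e \<in> set (awalk_verts (head G e) es)"
      using w by (rule hd_in_awalk_verts)
    then have "(u, head G e) \<in> arcs_avoiding G S"
      using Cons.prems(1) e in_arcs_imp_in_arcs_ends[OF e(1)] by (auto simp: arcs_avoiding_def)
    moreover have "(head G e, v) \<in> (arcs_avoiding G S)\<^sup>*"
      using Cons.IH w Cons.prems(1) by auto
    ultimately show ?case by (rule converse_rtrancl_into_rtrancl)
  qed
qed

lemma rtrancl_imp_avoiding_path:
  assumes "(u, v) \<in> (arcs_avoiding G S)\<^sup>*" "v \<in> verts G"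
  shows "\<exists>p. avoiding_path G S u p v"
proof -
  have "\<exists>p. awalk u p v \<and> tail G ` set p \<inter> S = {}"
    using assms(1)
  proof (induction rule: converse_rtrancl_induct)
    case base
    then show ?case using assms(2) by (intro exI[of _ "[]"]) (simp add: awalk_Nil_iff)
  next
    case (step x y)
    then obtain p where p: "awalk y p v" "tail G ` set p \<inter> S = {}" by blast
    obtain e where e: "e \<in> arcs G" "tail G e = x" "head G e = y" and "x \<notin> S"
      using step(1) by (auto simp: arcs_avoiding_def)
    then have "awalk x (e # p) v \<and> tail G ` set (e # p) \<inter> S = {}"
      using p by (auto simp: awalk_Cons_iff)
    then show ?case by blast
  qed
  then obtain p where p: "awalk u p v" "tail G ` set p \<inter> S = {}" by blast
  let ?q = "awalk_to_apath p"
  have "set (inner_verts ?q) \<subseteq> tail G ` set ?q"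
    by (cases ?q) (auto simp: inner_verts_def)
  then have "set (inner_verts ?q) \<inter> S = {}"
    using awalk_to_apath_subset[OF p(1)] p(2) by blast
  then show ?thesis
    using apath_awalk_to_apath[OF p(1)] by (auto simp: avoiding_path_def)
qed

lemma separating_pair_iff:
  assumes "clique G C" "clique G D"
  shows "separating_pair G C D \<longleftrightarrow>
    \<not> (\<exists>x\<in>C - D. \<exists>y\<in>D - C. (x, y) \<in> (arcs_avoiding G (C \<inter> D))\<^sup>*)"
proof -
  have "(\<exists>p. avoiding_path G (C \<inter> D) x p y) \<longleftrightarrow> (x, y) \<in> (arcs_avoiding G (C \<inter> D))\<^sup>*"
    if "x \<in> C - D" "y \<in> D - C" for x y
  proof -
    have "y \<in> verts G" using that assms by (auto simp: clique_def)
    then show ?thesis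
      using that avoiding_path_imp_rtrancl[of "C \<inter> D" x _ y]
        rtrancl_imp_avoiding_path[of x y "C \<inter> D"] by blast
  qed
  then show ?thesis unfolding separating_pair_def by blast
qed

lemma clique_connected_outside:
  assumes "clique G C" "x \<in> C - S" "y \<in> C - S"
  shows "(x, y) \<in> (arcs_avoiding G S)\<^sup>*"
proof (cases "x = y")
  case False
  then have "(x, y) \<in> arcs_avoiding G S"
    using assms by (auto simp: clique_def arcs_avoiding_def)
  then show ?thesis by blast
qed simp

section \<open>Maximal cliques\<close>

lemma maximal_clique_imp_clique: "maximal_clique G C \<Longrightarrow> clique G C"
  by (simp add: maximal_clique_def)

lemma maximal_clique_subset_eq:
  "\<lbrakk>maximal_clique G C; maximal_clique G D; C \<subseteq> D\<rbrakk> \<Longrightarrow> C = D"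
  by (auto simp: maximal_clique_def)

lemma clique_mono: "\<lbrakk>clique G C; D \<subseteq> C\<rbrakk> \<Longrightarrow> clique G D"
  by (auto simp: clique_def)

lemma finite_clique: "clique G C \<Longrightarrow> finite C"
  by (meson clique_def finite_verts finite_subset)

lemma clique_extends_to_maximal:
  assumes "clique G C"
  obtains D where "maximal_clique G D" "C \<subseteq> D"
proof -
  have "finite {D. clique G D}"
    by (rule finite_subset[of _ "Pow (verts G)"]) (auto simp: clique_def)
  then obtain D where "clique G D" "C \<subseteq> D" "\<forall>E. clique G E \<longrightarrow> D \<subseteq> E \<longrightarrow> D = E"
    using finite_has_maximal2[of "{D. clique G D}" C] assms by blast
  then show thesis using that[of D] unfolding maximal_clique_def by blast
qed

end

section \<open>Shortest paths in chordal graphs\<close>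

locale chordal_graph = graph +
  assumes chordal: "chordal G"
begin

text \<open>
  Chordality for cycles listed by their vertices. Requiring \<open>c n = c 0\<close> closes the cycle without
  modular arithmetic on the indices.
\<close>
lemma cycle_has_chord:
  assumes n: "4 \<le> n" and closed: "c n = c 0" and inj: "inj_on c {..<n}"
    and adj: "\<And>i. i < n \<Longrightarrow> c i \<rightarrow> c (Suc i)"
  obtains i j where "i < j" "j < n" "c i \<rightarrow> c j" "j \<noteq> Suc i" "\<not> (i = 0 \<and> j = n - 1)"
proof -
  have "\<exists>e. e \<in> arcs G \<and> tail G e = c i \<and> head G e = c (Suc i)" if "i < n" for i
    using adj[OF that] by (auto elim: reachableE)
  then obtain e where e: "\<And>i. i < n \<Longrightarrow> e i \<in> arcs G"
    "\<And>i. i < n \<Longrightarrow> tail G (e i) = c i" "\<And>i. i < n \<Longrightarrow> head G (e i) = c (Suc i)"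
    by metis
  let ?p = "map e [0..<n]"
  have "cas (c 0) (map e [0..<k]) (c k)" if "k \<le> n" for k
    using that
  proof (induction k)
    case (Suc k)
    then have IH: "cas (c 0) (map e [0..<k]) (c k)" and "k < n" by auto
    then have "awlast (c 0) (map e [0..<k]) = c k" by (intro awlast_if_cas)
    with IH show ?case using e \<open>k < n\<close> by simp
  qed simp
  then have cas: "cas (c 0) ?p (c 0)" using closed by (metis order_refl)
  have ne: "?p \<noteq> []" using n by simp
  have "c 0 \<in> verts G" using adj[of 0] n by (auto dest: adj_in_verts)
  then have "awalk (c 0) ?p (c 0)" using cas e(1) by (auto simp: awalk_def)
  moreover have "distinct (tl (awalk_verts (c 0) ?p))"
  proof -
    have "tl (awalk_verts (c 0) ?p) = map (\<lambda>i. c (Suc i)) [0..<n]"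
      using awalk_verts_conv'[OF cas] ne e(3) by auto
    moreover have "c (Suc i) \<noteq> c (Suc j)" if "i < j" "j < n" for i j
    proof (cases "Suc j = n")
      case True
      then have "c (Suc j) = c 0" using closed by simp
      then show ?thesis using inj_onD[OF inj, of "Suc i" 0] that True by auto
    next
      case False
      then show ?thesis using inj_onD[OF inj, of "Suc i" "Suc j"] that by auto
    qed
    then have "inj_on (\<lambda>i. c (Suc i)) {0..<n}"
      by (intro linorder_inj_onI) auto
    ultimately show ?thesis by (simp add: distinct_map)
  qed
  ultimately have "cycle ?p" unfolding cycle_def using ne by blast
  then obtain u v where ch: "is_chord G ?p u v"
    using chordal n unfolding chordal_def by fastforce
  then obtain i j where ij: "i < n" "j < n" "u = c i" "v = c j" "c i \<rightarrow> c j"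
    using e(2) by (auto simp: is_chord_def)
  have ends: "arc_to_ends G ` set ?p = (\<lambda>i. (c i, c (Suc i))) ` {..<n}"
    unfolding set_map image_image using e by (intro image_cong) (auto simp: arc_to_ends_def)
  have no_end: "(c i, c j) \<noteq> (c k, c (Suc k))" "(c j, c i) \<noteq> (c k, c (Suc k))" if "k < n" for k
    using ch that unfolding is_chord_def ends ij(3,4) by blast+
  have far: "Suc i \<noteq> j" "Suc j \<noteq> i" using no_end[OF ij(1)] no_end[OF ij(2)] by auto
  have wrap: "\<not> (i = 0 \<and> j = n - 1)" "\<not> (j = 0 \<and> i = n - 1)"
    using no_end[of "n - 1"] n closed by auto
  show thesis
  proof (cases i j rule: linorder_cases)
    case less
    then show thesis using that[of i j] ij far wrap by auto
  next
    case equal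
    then show thesis using ij dominates_irrefl by simp
  next
    case greater
    then show thesis using that[of j i] ij far wrap dominates_sym by auto
  qed
qed

text \<open>
  Two neighbours of \<open>t\<close> on an induced path with no neighbour of \<open>t\<close> between them would close,
  through \<open>t\<close>, a chordless cycle.
\<close>
lemma common_neighbour_of_ends:
  assumes inj: "inj_on p {..m}"
    and adj: "\<And>i. i < m \<Longrightarrow> p i \<rightarrow> p (Suc i)"
    and ind: "\<And>i j. \<lbrakk>Suc i < j; j \<le> m\<rbrakk> \<Longrightarrow> \<not> p i \<rightarrow> p j"
    and t: "t \<notin> p ` {..m}" "t \<rightarrow> p 0" "t \<rightarrow> p m"
    and "k \<le> m"
  shows "t \<rightarrow> p k"
proof (rule ccontr)
  assume nk: "\<not> t \<rightarrow> p k"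
  \<comment> \<open>The neighbours of \<open>t\<close> closest to \<open>p k\<close> on either side.\<close>
  define a where "a = Max {i. i < k \<and> t \<rightarrow> p i}"
  define b where "b = (LEAST i. k < i \<and> t \<rightarrow> p i)"
  have "0 < k" "k < m" using nk t \<open>k \<le> m\<close> by (auto intro!: gr0I le_neq_implies_less)
  have fin: "finite {i. i < k \<and> t \<rightarrow> p i}" by simp
  have a: "a < k" "t \<rightarrow> p a"
    using Max_in[OF fin] \<open>0 < k\<close> t(2) unfolding a_def by blast+
  have a_max: "i \<le> a" if "i < k" "t \<rightarrow> p i" for i
    unfolding a_def using Max_ge[OF fin] that by simp
  have b: "k < b" "t \<rightarrow> p b" "b \<le> m"
    using LeastI[of "\<lambda>i. k < i \<and> t \<rightarrow> p i" m] Least_le[of "\<lambda>i. k < i \<and> t \<rightarrow> p i" m]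
      \<open>k < m\<close> t(3) by (auto simp: b_def)
  have between: "\<not> t \<rightarrow> p i" if "a < i" "i < b" for i
  proof (cases i k rule: linorder_cases)
    case less
    then show ?thesis using a_max[of i] that by auto
  next
    case equal
    then show ?thesis using nk by simp
  next
    case greater
    then show ?thesis using not_less_Least[of i "\<lambda>i. k < i \<and> t \<rightarrow> p i"] that by (auto simp: b_def)
  qed
  define n where "n = b - a + 2"
  define c where "c i = (if i = 0 \<or> i = n then t else p (a + i - 1))" for i
  have n: "4 \<le> n" using a(1) b(1) by (simp add: n_def)
  have c0: "c 0 = t" "c n = t" by (simp_all add: c_def)
  have cS: "c (Suc i) = p (a + i)" if "i \<le> b - a" for i
    using that by (simp add: c_def n_def)
  have le: "a + i \<le> m" if "i \<le> b - a" for i using that a b by simp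
  have "inj_on c {..<n}"
  proof (rule linorder_inj_onI)
    fix i j assume ij: "i < j" "i \<in> {..<n}" "j \<in> {..<n}"
    obtain j' where j: "j = Suc j'" "j' \<le> b - a" using ij by (cases j) (auto simp: n_def)
    show "c i \<noteq> c j"
    proof (cases i)
      case 0
      then show ?thesis using t(1) le[OF j(2)] by (auto simp: c0 j(1) cS[OF j(2)])
    next
      case (Suc i')
      then have "i' \<le> b - a" "i' < j'" using ij j by auto
      then have "p (a + i') \<noteq> p (a + j')"
        using inj_onD[OF inj, of "a + i'" "a + j'"] le j(2) by auto
      then show ?thesis using Suc \<open>i' \<le> b - a\<close> j by (simp add: cS)
    qed
  qed auto
  moreover have "c i \<rightarrow> c (Suc i)" if "i < n" for i
  proof (cases i)
    case 0
    then show ?thesis using a(2) by (simp add: c0 cS)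
  next
    case (Suc i')
    show ?thesis
    proof (cases "i' = b - a")
      case True
      then have "Suc i = n" "c i = p b" using Suc a b cS[of i'] by (auto simp: n_def)
      then show ?thesis using b(2) dominates_sym by (auto simp: c0)
    next
      case False
      then have "Suc i' \<le> b - a" using that Suc by (simp add: n_def)
      then show ?thesis using adj[of "a + i'"] b(3) by (simp add: Suc cS)
    qed
  qed
  ultimately obtain i j where ij: "i < j" "j < n" "c i \<rightarrow> c j" "j \<noteq> Suc i" "\<not> (i = 0 \<and> j = n - 1)"
    using cycle_has_chord[OF n] c0 by metis
  obtain j' where j: "j = Suc j'" "j' \<le> b - a" using ij by (cases j) (auto simp: n_def)
  show False
  proof (cases i)
    case 0
    then have "t \<rightarrow> p (a + j')" "0 < j'" "j' < b - a"
      using ij j a b by (auto simp: c0 cS n_def intro!: gr0I)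
    then show False using between[of "a + j'"] by auto
  next
    case (Suc i')
    then have "p (a + i') \<rightarrow> p (a + j')" "Suc i' < j'" using ij j by (auto simp: cS)
    then show False using ind[of "a + i'" "a + j'"] le[OF j(2)] by auto
  qed
qed

section \<open>Chains of maximal cliques\<close>

text \<open>
  All vertices of a shortest path outside \<open>T\<close> from \<open>C\<close> to \<open>D\<close> are complete to \<open>T\<close>, so each edge
  of it together with \<open>T\<close> extends to a maximal clique; consecutive ones share \<open>T\<close> and a vertex
  of the path.
\<close>
lemma clique_chain:
  assumes C: "maximal_clique G C" "T \<subseteq> C" "x \<in> C - T"
    and D: "maximal_clique G D" "T \<subseteq> D" "y \<in> D - T"
    and conn: "(x, y) \<in> (arcs_avoiding G T)\<^sup>*"
  shows "(C, D) \<in> {(E, F). maximal_clique G E \<and> maximal_clique G F \<and> T \<subset> E \<inter> F}\<^sup>*"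
    (is "_ \<in> ?L\<^sup>*")
proof -
  let ?R = "arcs_avoiding G T"
  define m where "m = (LEAST m. (x, y) \<in> ?R ^^ m)"
  have "(x, y) \<in> ?R ^^ m"
    unfolding m_def using conn by (metis LeastI rtrancl_imp_relpow)
  then obtain p where p: "p 0 = x" "p m = y" "\<And>i. i < m \<Longrightarrow> (p i, p (Suc i)) \<in> ?R"
    by (auto simp: relpow_fun_conv)
  have shortest: "m \<le> k" if "(x, y) \<in> ?R ^^ k" for k
    unfolding m_def using that by (rule Least_le)
  have sub: "(p i, p (i + k)) \<in> ?R ^^ k" if "i + k \<le> m" for i k
    unfolding relpow_fun_conv using that p(3) by (intro exI[of _ "\<lambda>l. p (i + l)"]) auto
  have shortcut: "j \<le> i + k" if "i \<le> j" "j \<le> m" "(p i, p j) \<in> ?R ^^ k" for i j k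
  proof -
    have "(p 0, p i) \<in> ?R ^^ i" "(p j, p m) \<in> ?R ^^ (m - j)"
      using sub[of 0 i] sub[of j "m - j"] that by auto
    then have "(x, y) \<in> ?R ^^ (i + k + (m - j))"
      using that(3) p(1,2) by (auto simp: relpow_add)
    then show ?thesis using shortest that(2) by fastforce
  qed
  have out: "p i \<notin> T" if "i \<le> m" for i
    using that p(3)[of i] p(2) D(3) by (cases "i = m") (auto simp: arcs_avoiding_def)
  have inj: "inj_on p {..m}"
  proof (rule linorder_inj_onI)
    fix i j assume "i < j" "j \<in> {..m}"
    then show "p i \<noteq> p j" using shortcut[of i j 0] by auto
  qed auto
  have adj: "p i \<rightarrow> p (Suc i)" if "i < m" for i
    using p(3)[OF that] by (simp add: arcs_avoiding_def)
  have ind: "\<not> p i \<rightarrow> p j" if "Suc i < j" "j \<le> m" for i j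
    using shortcut[of i j 1] that out[of i] out[of j] by (auto simp: arcs_avoiding_def)
  have clC: "clique G C" and clD: "clique G D"
    using C D by (auto simp: maximal_clique_imp_clique)
  have complete: "t \<rightarrow> p i" if "t \<in> T" "i \<le> m" for t i
  proof (rule common_neighbour_of_ends[OF inj adj ind _ _ _ that(2)])
    show "t \<notin> p ` {..m}" using out that(1) by auto
    have "t \<noteq> x" "t \<noteq> y" using that(1) C(3) D(3) by auto
    then show "t \<rightarrow> p 0" "t \<rightarrow> p m"
      using clC clD C(2,3) D(2,3) that(1) p(1,2) unfolding clique_def by blast+
  qed
  have "\<exists>E. maximal_clique G E \<and> insert (p k) T \<subseteq> E \<and> (C, E) \<in> ?L\<^sup>*" if "k \<le> m" for k
    using that
  proof (induction k)
    case 0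
    then show ?case using C p(1) by auto
  next
    case (Suc k)
    then obtain E where E: "maximal_clique G E" "insert (p k) T \<subseteq> E" "(C, E) \<in> ?L\<^sup>*" by auto
    have k: "k < m" using Suc.prems by simp
    have "clique G T" using clC C(2) by (rule clique_mono)
    then have "clique G (insert (p k) (insert (p (Suc k)) T))"
      using adj[OF k] k complete[of _ k] complete[of _ "Suc k"]
      by (auto simp: clique_def dominates_sym adj_in_verts)
    then obtain F where F: "maximal_clique G F" "insert (p k) (insert (p (Suc k)) T) \<subseteq> F"
      by (rule clique_extends_to_maximal)
    have "(E, F) \<in> ?L" using E F out[of k] k by auto
    then show ?case using E(3) F by (meson insert_subset rtrancl.rtrancl_into_rtrancl)
  qed
  then obtain E where E: "maximal_clique G E" "insert (p m) T \<subseteq> E" "(C, E) \<in> ?L\<^sup>*" by blast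
  have "(E, D) \<in> ?L" using E D p(2) by auto
  then show ?thesis using E(3) by (rule rtrancl_into_rtrancl[rotated])
qed

definition reduced_above :: "'a set \<Rightarrow> ('a set \<times> 'a set) set" where
  "reduced_above T = {(C, D) \<in> parcs (reduced_clique_graph G). T \<subset> C \<inter> D}"

lemma reduced_aboveD:
  assumes "(C, D) \<in> reduced_above T"
  shows "(C, D) \<in> parcs (reduced_clique_graph G)"
    "maximal_clique G C" "maximal_clique G D" "C \<noteq> D" "T \<subset> C \<inter> D"
  using assms by (auto simp: reduced_above_def reduced_clique_graph_def)

lemma reduced_arcD:
  assumes "(C, D) \<in> parcs (reduced_clique_graph G)"
  shows "maximal_clique G C" "maximal_clique G D" "C \<noteq> D" "C \<inter> D \<noteq> {}" "separating_pair G C D"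
  using assms by (auto simp: reduced_clique_graph_def)

text \<open>
  A pair that is not separating is refined by a chain of cliques with strictly larger
  intersections, so induction on the size of the intersection ends in separating pairs.
\<close>
lemma reduced_chain_if_meet_above:
  assumes "maximal_clique G C" "maximal_clique G D" "T \<subset> C \<inter> D"
  shows "(C, D) \<in> (reduced_above T)\<^sup>*"
  using assms
proof (induction "card (verts G) - card (C \<inter> D)" arbitrary: C D rule: less_induct)
  case less
  have cl: "clique G C" "clique G D" using less.prems by (auto simp: maximal_clique_imp_clique)
  show ?case
  proof (cases "C = D \<or> separating_pair G C D")
    case True
    then show ?thesis
      using less.prems by (auto simp: reduced_above_def reduced_clique_graph_def)
  next
    case False
    then obtain x y where xy: "x \<in> C - D" "y \<in> D - C"
      "(x, y) \<in> (arcs_avoiding G (C \<inter> D))\<^sup>*"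
      using separating_pair_iff[OF cl] by blast
    let ?L = "{(E, F). maximal_clique G E \<and> maximal_clique G F \<and> C \<inter> D \<subset> E \<inter> F}"
    have "(C, D) \<in> ?L\<^sup>*"
      using clique_chain[of C "C \<inter> D" x D y] less.prems xy by blast
    moreover have "?L \<subseteq> (reduced_above T)\<^sup>*"
    proof (rule subrelI)
      fix E F assume "(E, F) \<in> ?L"
      then have EF: "maximal_clique G E" "maximal_clique G F" "C \<inter> D \<subset> E \<inter> F" by auto
      have sub: "E \<inter> F \<subseteq> verts G" using EF(1) by (auto simp: maximal_clique_def clique_def)
      have "card (C \<inter> D) < card (E \<inter> F)"
        using finite_subset[OF sub finite_verts] EF(3) by (rule psubset_card_mono)
      moreover have "card (E \<inter> F) \<le> card (verts G)"
        using finite_verts sub by (rule card_mono)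
      ultimately have "card (verts G) - card (E \<inter> F) < card (verts G) - card (C \<inter> D)"
        by simp
      then show "(E, F) \<in> (reduced_above T)\<^sup>*"
        using less.hyps[of E F] less.prems EF by auto
    qed
    ultimately show ?thesis using rtrancl_subset_rtrancl by blast
  qed
qed

text \<open>
  The next two lemmas identify the classes of maximal cliques containing \<open>T\<close>: lying in the
  same component outside \<open>T\<close> is the same as being joined by reduced arcs above \<open>T\<close>.
\<close>
lemma reduced_chain:
  assumes "maximal_clique G C" "T \<subseteq> C" "x \<in> C - T"
    and "maximal_clique G D" "T \<subseteq> D" "y \<in> D - T"
    and "(x, y) \<in> (arcs_avoiding G T)\<^sup>*"
  shows "(C, D) \<in> (reduced_above T)\<^sup>*"
proof -
  have "{(E, F). maximal_clique G E \<and> maximal_clique G F \<and> T \<subset> E \<inter> F} \<subseteq> (reduced_above T)\<^sup>*"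
    using reduced_chain_if_meet_above by auto
  from subsetD[OF rtrancl_subset_rtrancl[OF this] clique_chain[OF assms]] show ?thesis .
qed

lemma reduced_chain_connected_outside:
  assumes "(C, D) \<in> (reduced_above T)\<^sup>*" "clique G C" "x \<in> C - T" "y \<in> D - T"
  shows "(x, y) \<in> (arcs_avoiding G T)\<^sup>*"
  using assms(1,4)
proof (induction arbitrary: y rule: rtrancl_induct)
  case base
  then show ?case using clique_connected_outside assms(2,3) by blast
next
  case (step D E)
  then obtain z where "z \<in> D - T" "z \<in> E - T" using reduced_aboveD(5)[OF step(2)] by blast
  moreover have "clique G E" using reduced_aboveD(3)[OF step(2)] by (rule maximal_clique_imp_clique)
  ultimately show ?case
    using step.IH[of z] clique_connected_outside[of E z T y] step.prems by (meson rtrancl_trans)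
qed

text \<open>
  A common vertex outside \<open>T\<close>, or a path around \<open>T\<close>, would put \<open>C\<close> and \<open>D\<close> into the same class.
\<close>
lemma different_classes_adjacent:
  assumes T: "T \<noteq> {}" and C: "maximal_clique G C" "T \<subseteq> C" and D: "maximal_clique G D" "T \<subseteq> D"
    and unrel: "(C, D) \<notin> (reduced_above T)\<^sup>*"
  shows "(C, D) \<in> parcs (reduced_clique_graph G)"
proof -
  have "C \<inter> D = T" using reduced_chain_if_meet_above[OF C(1) D(1), of T] unrel C D by blast
  moreover have "C \<noteq> D" using unrel by auto
  moreover have "separating_pair G C D"
    unfolding separating_pair_iff[OF maximal_clique_imp_clique[OF C(1)]
        maximal_clique_imp_clique[OF D(1)]]
    using reduced_chain[OF C _ D] unrel \<open>C \<inter> D = T\<close> by blast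
  ultimately show ?thesis using C D T by (auto simp: reduced_clique_graph_def)
qed

lemma reduced_arc_different_classes:
  assumes "(C, D) \<in> parcs (reduced_clique_graph G)"
  shows "(C, D) \<notin> (reduced_above (C \<inter> D))\<^sup>*"
proof
  assume chain: "(C, D) \<in> (reduced_above (C \<inter> D))\<^sup>*"
  note CD = reduced_arcD[OF assms]
  have cl: "clique G C" "clique G D" using CD by (auto simp: maximal_clique_imp_clique)
  obtain x y where xy: "x \<in> C - D" "y \<in> D - C"
    using maximal_clique_subset_eq CD(1-3) by (metis Diff_eq_empty_iff ex_in_conv)
  then have "(x, y) \<in> (arcs_avoiding G (C \<inter> D))\<^sup>*"
    using reduced_chain_connected_outside[OF chain cl(1)] by blast
  then show False using CD(5) xy unfolding separating_pair_iff[OF cl] by blast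
qed

section \<open>Triangle-free clique graphs\<close>

lemma clique_graph_eq_reduced_if_triangle_free:
  assumes free: "\<And>C D E. \<not> ((C, D) \<in> parcs (clique_graph G) \<and> (D, E) \<in> parcs (clique_graph G)
      \<and> (C, E) \<in> parcs (clique_graph G))"
  shows "clique_graph G = reduced_clique_graph G"
proof -
  have "separating_pair G C D" if CD: "maximal_clique G C" "maximal_clique G D" "C \<noteq> D"
    "C \<inter> D \<noteq> {}" for C D
  proof (rule ccontr)
    assume "\<not> separating_pair G C D"
    then obtain x y where "x \<in> C - D" "y \<in> D - C" "(x, y) \<in> (arcs_avoiding G (C \<inter> D))\<^sup>*"
      using CD(1,2) separating_pair_iff[of C D] maximal_clique_imp_clique by blast
    then have "(C, D) \<in> (reduced_above (C \<inter> D))\<^sup>*"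
      using reduced_chain[of C "C \<inter> D" x D y] CD by blast
    \<comment> \<open>The first clique of the chain after \<open>C\<close> completes a triangle.\<close>
    then obtain E where "(C, E) \<in> reduced_above (C \<inter> D)"
      using CD(3) by (meson converse_rtranclE)
    note E = reduced_aboveD[OF this]
    have "(C, E) \<in> parcs (clique_graph G)" "(E, D) \<in> parcs (clique_graph G)"
      "(C, D) \<in> parcs (clique_graph G)"
      using CD E(2-5) by (auto simp: clique_graph_def)
    then show False using free by blast
  qed
  then show ?thesis unfolding clique_graph_def reduced_clique_graph_def by auto
qed

context
  assumes triangle_free:
    "\<And>C D E. \<not> ((C, D) \<in> parcs (reduced_clique_graph G)
      \<and> (D, E) \<in> parcs (reduced_clique_graph G) \<and> (C, E) \<in> parcs (reduced_clique_graph G))"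
begin

text \<open>
  A further clique \<open>E\<close> above \<open>C \<inter> D\<close> either belongs to a third class, and then is adjacent to both
  \<open>C\<close> and \<open>D\<close>, or shows that the class of \<open>C\<close> or of \<open>D\<close> contains an arc, whose ends are both
  adjacent to any member of the other class.
\<close>
lemma only_two_cliques_above_edge:
  assumes CD: "(C, D) \<in> parcs (reduced_clique_graph G)"
    and E: "maximal_clique G E" "C \<inter> D \<subseteq> E"
  shows "E = C \<or> E = D"
proof (rule ccontr)
  assume neq: "\<not> (E = C \<or> E = D)"
  let ?S = "C \<inter> D" and ?H = "parcs (reduced_clique_graph G)"
  note C = reduced_arcD(1)[OF CD] and D = reduced_arcD(2)[OF CD]
  have unrel: "(C, D) \<notin> (reduced_above ?S)\<^sup>*" using CD by (rule reduced_arc_different_classes)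
  have adjC: "(C, F) \<in> ?H" if "maximal_clique G F" "?S \<subseteq> F" "(C, F) \<notin> (reduced_above ?S)\<^sup>*" for F
    using different_classes_adjacent[OF reduced_arcD(4)[OF CD] C _ that(1,2)] that(3) by blast
  have adjD: "(F, D) \<in> ?H" if "maximal_clique G F" "?S \<subseteq> F" "(F, D) \<notin> (reduced_above ?S)\<^sup>*" for F
    using different_classes_adjacent[OF reduced_arcD(4)[OF CD] that(1,2) D] that(3) by blast
  consider (C) "(C, E) \<in> (reduced_above ?S)\<^sup>*" | (D) "(E, D) \<in> (reduced_above ?S)\<^sup>*"
    | (third) "(C, E) \<notin> (reduced_above ?S)\<^sup>*" "(E, D) \<notin> (reduced_above ?S)\<^sup>*" by blast
  then show False
  proof cases
    case C
    then obtain F where F: "(C, F) \<in> reduced_above ?S" using neq by (metis converse_rtranclE)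
    then have "(F, D) \<notin> (reduced_above ?S)\<^sup>*"
      using unrel by (meson converse_rtrancl_into_rtrancl)
    then have "(F, D) \<in> ?H" using adjD reduced_aboveD[OF F] by blast
    then show False using triangle_free CD reduced_aboveD(1)[OF F] by blast
  next
    case D
    then obtain F where F: "(F, D) \<in> reduced_above ?S" using neq by (metis rtranclE)
    then have "(C, F) \<notin> (reduced_above ?S)\<^sup>*"
      using unrel by (meson rtrancl_into_rtrancl)
    then have "(C, F) \<in> ?H" using adjC reduced_aboveD[OF F] by blast
    then show False using triangle_free CD reduced_aboveD(1)[OF F] by blast
  next
    case third
    then show False using adjC[OF E] adjD[OF E] triangle_free CD by blast
  qed
qed

text \<open>
  The witness \<open>A\<close> consists of the cliques that reach into the component of \<open>C - D\<close> outside
  \<open>C \<inter> D\<close>. The ends of an arc leaving \<open>A\<close> share no vertex outside \<open>C \<inter> D\<close>, so minimality forces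
  both to contain \<open>C \<inter> D\<close>, and only \<open>C\<close> and \<open>D\<close> do.
\<close>
lemma minimum_edge_is_bridge:
  assumes CD: "(C, D) \<in> parcs (reduced_clique_graph G)"
    and min: "\<And>E F. (E, F) \<in> parcs (reduced_clique_graph G) \<Longrightarrow> card (C \<inter> D) \<le> card (E \<inter> F)"
  obtains A where "C \<in> A" "D \<notin> A"
    "\<And>E F. \<lbrakk>(E, F) \<in> parcs (reduced_clique_graph G); E \<in> A; F \<notin> A\<rbrakk> \<Longrightarrow> E = C \<and> F = D"
proof
  let ?S = "C \<inter> D"
  let ?A = "{E. \<exists>x\<in>C - ?S. \<exists>y\<in>E - ?S. (x, y) \<in> (arcs_avoiding G ?S)\<^sup>*}"
  note arc = reduced_arcD[OF CD]
  have cl: "clique G C" "clique G D" using arc by (auto simp: maximal_clique_imp_clique)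
  obtain x where "x \<in> C - ?S"
    using maximal_clique_subset_eq[OF arc(1,2)] arc(3) by blast
  then show CA: "C \<in> ?A" by blast
  have "C - ?S = C - D" "D - ?S = D - C" by auto
  then show DA: "D \<notin> ?A" using arc(5) unfolding separating_pair_iff[OF cl] by auto
  fix E F assume EF: "(E, F) \<in> parcs (reduced_clique_graph G)" "E \<in> ?A" "F \<notin> ?A"
  note arc' = reduced_arcD[OF EF(1)]
  have clE: "clique G E" using arc'(1) by (rule maximal_clique_imp_clique)
  obtain x y where xy: "x \<in> C - ?S" "y \<in> E - ?S" "(x, y) \<in> (arcs_avoiding G ?S)\<^sup>*"
    using EF(2) by blast
  have "E \<inter> F \<subseteq> ?S"
  proof
    fix z assume z: "z \<in> E \<inter> F"
    show "z \<in> ?S"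
    proof (rule ccontr)
      assume "z \<notin> ?S"
      then have "(x, z) \<in> (arcs_avoiding G ?S)\<^sup>*"
        using clique_connected_outside[OF clE xy(2), of z] z xy(3) by (auto intro: rtrancl_trans)
      then show False using EF(3) xy(1) z \<open>z \<notin> ?S\<close> by blast
    qed
  qed
  then have "E \<inter> F = ?S"
    using min[OF EF(1)] finite_clique[OF cl(1)] by (intro card_seteq) auto
  then have "E = C \<or> E = D" "F = C \<or> F = D"
    using only_two_cliques_above_edge[OF CD] arc'(1,2) by blast+
  then show "E = C \<and> F = D" using EF(2,3) CA DA by blast
qed

end

end

section \<open>Cycles\<close>

lemma cycle_graph_arc_iff:
  "(i, j) \<in> parcs (cycle_graph n) \<longleftrightarrow>
    i < n \<and> j < n \<and> (j = Suc i \<or> i = Suc j \<or> (i = 0 \<or> j = 0) \<and> Suc (i + j) = n)"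
  by (auto simp: cycle_graph_def mod_Suc)

lemma cycle_graph_triangle_free:
  assumes "4 \<le> n"
  shows "\<not> ((i, j) \<in> parcs (cycle_graph n) \<and> (j, k) \<in> parcs (cycle_graph n)
    \<and> (i, k) \<in> parcs (cycle_graph n))"
  using assms unfolding cycle_graph_arc_iff by auto

lemma pair_wf_cycle_graph: "pair_wf_digraph (cycle_graph n)"
  by unfold_locales (auto simp: cycle_graph_def)

lemma pair_wf_clique_graph: "pair_wf_digraph (clique_graph G)"
  by unfold_locales (auto simp: clique_graph_def)

lemma pair_wf_reduced_clique_graph: "pair_wf_digraph (reduced_clique_graph G)"
  by unfold_locales (auto simp: reduced_clique_graph_def)

lemma triangle_free_if_iso_cycle:
  assumes wf: "pair_wf_digraph H" and "4 \<le> n"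
    and iso: "digraph_iso (with_proj H) (with_proj (cycle_graph n))"
  shows "\<not> ((u, v) \<in> parcs H \<and> (v, w) \<in> parcs H \<and> (u, w) \<in> parcs H)"
proof
  assume uvw: "(u, v) \<in> parcs H \<and> (v, w) \<in> parcs H \<and> (u, w) \<in> parcs H"
  obtain f where "\<forall>u\<in>pverts H. \<forall>v\<in>pverts H. (u, v) \<in> parcs H \<longleftrightarrow> (f u, f v) \<in> parcs (cycle_graph n)"
    using iso unfolding digraph_iso_with_proj_iff[OF wf pair_wf_cycle_graph] by blast
  then have "(f u, f v) \<in> parcs (cycle_graph n)" "(f v, f w) \<in> parcs (cycle_graph n)"
    "(f u, f w) \<in> parcs (cycle_graph n)"
    using uvw pair_wf_digraph.wellformed'[OF wf] by blast+
  then show False using cycle_graph_triangle_free[OF \<open>4 \<le> n\<close>] by blast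
qed

lemma (in chordal_graph) reduced_clique_graph_not_cycle:
  assumes n: "4 \<le> n"
  shows "\<not> digraph_iso (with_proj (reduced_clique_graph G)) (with_proj (cycle_graph n))"
proof
  let ?H = "parcs (reduced_clique_graph G)" and ?V = "pverts (reduced_clique_graph G)"
  assume iso: "digraph_iso (with_proj (reduced_clique_graph G)) (with_proj (cycle_graph n))"
  note free = triangle_free_if_iso_cycle[OF pair_wf_reduced_clique_graph n iso]
  obtain f where f: "bij_betw f ?V {..<n}"
    and adj: "\<And>C D. \<lbrakk>C \<in> ?V; D \<in> ?V\<rbrakk> \<Longrightarrow> (C, D) \<in> ?H \<longleftrightarrow> (f C, f D) \<in> parcs (cycle_graph n)"
    using iso
    unfolding digraph_iso_with_proj_iff[OF pair_wf_reduced_clique_graph pair_wf_cycle_graph]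
    by (auto simp: cycle_graph_def)
  \<comment> \<open>The cliques in cyclic order, indexed with period \<open>n\<close>.\<close>
  define e where "e i = inv_into ?V f (i mod n)" for i
  have e: "e i \<in> ?V" "f (e i) = i mod n" for i
    using f n bij_betw_inv_into_right[OF f, of "i mod n"]
      bij_betw_apply[OF bij_betw_inv_into[OF f], of "i mod n"] by (auto simp: e_def)
  have e_eq: "e i = e j \<longleftrightarrow> i mod n = j mod n" for i j
    using e(2) by (metis e_def)
  have arc: "(e i, e (Suc i)) \<in> ?H" "(e (Suc i), e i) \<in> ?H" for i
    using n mod_less_divisor[of n i] by (auto simp: adj e cycle_graph_def mod_Suc Suc_lessI)
  have arcs: "\<exists>i. {C, D} = {e i, e (Suc i)}" if "(C, D) \<in> ?H" for C D
  proof -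
    have V: "C \<in> ?V" "D \<in> ?V"
      using pair_wf_digraph.wellformed'[OF pair_wf_reduced_clique_graph that] by auto
    then have "(f C, f D) \<in> parcs (cycle_graph n)" using adj that by simp
    then have "f D = Suc (f C) mod n \<or> f C = Suc (f D) mod n" and lt: "f C < n" "f D < n"
      by (auto simp: cycle_graph_def)
    moreover have "C = e (f C)" "D = e (f D)"
      using V lt f by (auto simp: e_def bij_betw_def)
    ultimately show ?thesis by (metis e_eq insert_commute mod_mod_trivial)
  qed
  obtain i where i: "\<And>j. card (e i \<inter> e (Suc i)) \<le> card (e j \<inter> e (Suc j))"
    using exists_least_iff[of "\<lambda>k. \<exists>j. k = card (e j \<inter> e (Suc j))"] by (metis not_le)
  have min: "card (e i \<inter> e (Suc i)) \<le> card (C \<inter> D)" if CD: "(C, D) \<in> ?H" for C D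
  proof -
    obtain j where "{C, D} = {e j, e (Suc j)}" using arcs[OF CD] by blast
    then have "C \<inter> D = e j \<inter> e (Suc j)" by (auto simp: doubleton_eq_iff)
    then show ?thesis using i[of j] by simp
  qed
  obtain A where A: "e i \<in> A" "e (Suc i) \<notin> A"
    "\<And>C D. \<lbrakk>(C, D) \<in> ?H; C \<in> A; D \<notin> A\<rbrakk> \<Longrightarrow> C = e i \<and> D = e (Suc i)"
    using minimum_edge_is_bridge[OF free arc(1) min] by blast
  \<comment> \<open>Going around from \<open>e (i + n) = e i\<close> down to \<open>e (Suc i)\<close> never uses the bridge.\<close>
  have "e (i + (n - k)) \<in> A" if "k < n" for k
    using that
  proof (induction k)
    case 0
    have "e (i + n) = e i" by (simp add: e_eq)
    then show ?case using A(1) by simp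
  next
    case (Suc k)
    let ?l = "n - Suc k"
    have l: "n - k = Suc ?l" "0 < ?l" "?l < n" using Suc.prems by auto
    show ?case
    proof (rule ccontr)
      assume "e (i + ?l) \<notin> A"
      moreover have "e (Suc (i + ?l)) \<in> A" using Suc l by simp
      ultimately have "e (i + ?l) = e (Suc i)" "e (Suc (i + ?l)) = e i"
        using A(3) arc(2) by blast+
      then have "e (Suc (Suc i)) = e i"
        unfolding e_eq by (metis mod_Suc_eq)
      then have "Suc (Suc i) mod n = i mod n" by (simp only: e_eq)
      then show False using n by (auto simp: mod_Suc split: if_splits)
    qed
  qed
  from this[of "n - 1"] show False using A(2) n by simp
qed

theorem proposition3p9:
  fixes n :: nat
  assumes "n \<ge> 4"
  shows "\<not> (\<exists>G :: ('a, 'b) pre_digraph. graph G \<and> chordal G \<and>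
           (digraph_iso (with_proj (clique_graph G)) (with_proj (cycle_graph n)) \<or>
            digraph_iso (with_proj (reduced_clique_graph G)) (with_proj (cycle_graph n))))"
proof clarify
  fix G :: "('a, 'b) pre_digraph"
  assume "graph G" "chordal G"
    and iso: "digraph_iso (with_proj (clique_graph G)) (with_proj (cycle_graph n)) \<or>
      digraph_iso (with_proj (reduced_clique_graph G)) (with_proj (cycle_graph n))"
  then interpret chordal_graph G by (simp add: chordal_graph_def chordal_graph_axioms_def)
  have "clique_graph G = reduced_clique_graph G"
    if "digraph_iso (with_proj (clique_graph G)) (with_proj (cycle_graph n))"
    using clique_graph_eq_reduced_if_triangle_free
      triangle_free_if_iso_cycle[OF pair_wf_clique_graph assms that] by blast
  then show False using iso reduced_clique_graph_not_cycle[OF assms] by metis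
qed

end
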